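(* Let $\mathbb{X}$ and $\mathbb{Y}$ be two real normed linear spaces. Let $T$ be a rotund point of (the unit ball of) $\mathbb{B}(\mathbb{X},\mathbb{Y})$. Then for any $A \in \mathbb{B}(\mathbb{X},\mathbb{Y})$, $T \perp_B A$ if and only if there exist two sequences $\{x_n\}$, $\{y_n\}$ in $S_{\mathbb{X}}$ and two sequences of positive real numbers $\{\epsilon_n\}$, $\{\delta_n\}$ in $[0,1)$ such that: (i) $\epsilon_n \to 0$ and $\delta_n \to 0$ as $n \to \infty$; (ii) $\|Tx_n\| \to \|T\|$ and $\|Ty_n\| \to \|T\|$ as $n \to \infty$; (iii) $Ax_n \in (Tx_n)^{+(\epsilon_n)}$ and $Ay_n \in (Ty_n)^{-(\delta_n)}$ for all $n \in \mathbb{N}$.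
   Context: All normed linear spaces are real. $\mathbb{B}(\mathbb{X},\mathbb{Y})$ is the space of bounded linear operators from $\mathbb{X}$ to $\mathbb{Y}$ with the operator norm. For a normed linear space $\mathbb{Z}$, $B_{\mathbb{Z}} = \{z : \|z\| \le 1\}$ and $S_{\mathbb{Z}} = \{z : \|z\| = 1\}$. An element $x \in S_{\mathbb{Z}}$ is a rotund point of $B_{\mathbb{Z}}$ if $\|y\| = \|\frac{x+y}{2}\| = 1$ implies $x = y$; in the claim this is applied with $\mathbb{Z} = \mathbb{B}(\mathbb{X},\mathbb{Y})$ (so in particular $\|T\| = 1$). Birkhoff-James orthogonality: $T \perp_B A$ means $\|T\| \le \|T + \lambda A\|$ for all $\lambda \in \mathbb{R}$. For $u, v$ in a normed linear space and $\epsilon \in [0,1)$, $v \in u^{+(\epsilon)}$ means $\|u + \lambda v\| \ge \sqrt{1-\epsilon^2}\,\|u\|$ for all $\lambda \ge 0$, and $v \in u^{-(\epsilon)}$ means $\|u + \lambda v\| \ge \sqrt{1-\epsilon^2}\,\|u\|$ for all $\lambda \le 0$. *)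

theory Defs
  imports "HOL-Analysis.Analysis"
begin

definition rotund_point :: "'a::real_normed_vector \<Rightarrow> bool" where
  "rotund_point x \<longleftrightarrow>
     x \<in> sphere 0 1 \<and> (\<forall>y. norm y = 1 \<and> norm ((x + y) /\<^sub>R 2) = 1 \<longrightarrow> x = y)"

definition bj_orthogonal :: "'a::real_normed_vector \<Rightarrow> 'a \<Rightarrow> bool" (infix \<open>\<bottom>\<^sub>B\<close> 50) where
  "x \<bottom>\<^sub>B y \<longleftrightarrow> (\<forall>t::real. norm x \<le> norm (x + t *\<^sub>R y))"

text \<open>The approximate half-cones of directions at u, usually written with exponents +(\<epsilon>) and -(\<epsilon>).
  They are meant for \<epsilon> in [0,1); this restriction is not part of the definitions and has to be
  imposed where they are used.\<close>

definition eps_plus :: "real \<Rightarrow> 'a::real_normed_vector \<Rightarrow> 'a set" where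
  "eps_plus \<epsilon> u = {v. \<forall>t\<ge>0. norm (u + t *\<^sub>R v) \<ge> sqrt (1 - \<epsilon>\<^sup>2) * norm u}"

definition eps_minus :: "real \<Rightarrow> 'a::real_normed_vector \<Rightarrow> 'a set" where
  "eps_minus \<epsilon> u = {v. \<forall>t\<le>0. norm (u + t *\<^sub>R v) \<ge> sqrt (1 - \<epsilon>\<^sup>2) * norm u}"

end

theory Submission
  imports Defs
begin

text \<open>If \<open>T \<bottom>\<^sub>B A\<close> and \<open>A \<noteq> 0\<close>, rotundity forces \<open>norm (T + r A) > 1\<close> for every \<open>r > 0\<close>, so
  some unit vector \<open>x\<close> satisfies \<open>norm (T x + r A x) > 1 \<ge> norm (T x)\<close>. The convex function
  \<open>t \<mapsto> norm (T x + t A x)\<close> therefore stays above \<open>norm (T x)\<close> for \<open>t \<ge> r\<close>, while on \<open>[0, r]\<close> it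
  drops by at most \<open>r * norm A\<close>. Letting \<open>r\<close> tend to \<open>0\<close> gives \<open>x\<^sub>n\<close>, and \<open>-A\<close> in place of \<open>A\<close>
  gives \<open>y\<^sub>n\<close>. Conversely, \<open>norm (T + t A) \<ge> norm (T x\<^sub>n + t A x\<^sub>n)\<close>, and one passes to the limit.\<close>

text \<open>The operator norm is a supremum that need not be attained, hence a level
  \<open>c\<close> strictly below it. The bound \<open>0 \<le> c\<close> forces \<open>B\<close> to
  be nonzero and so excludes the zero space, which has no unit vectors.\<close>

lemma blinfun_norm_witness:
  fixes B :: "'a::real_normed_vector \<Rightarrow>\<^sub>L 'b::real_normed_vector"
  assumes "0 \<le> c" "c < norm B"
  obtains x where "norm x = 1" "c < norm (B x)"
proof -
  have "\<exists>z. \<not> norm (B z) \<le> c * norm z"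
    using norm_blinfun_bound[of c B] assms by force
  then obtain z where z: "c * norm z < norm (B z)"
    unfolding not_le ..
  then have nz: "norm z > 0"
    by (cases "z = 0") auto
  show thesis
  proof (rule that)
    show "norm (z /\<^sub>R norm z) = 1"
      using nz by simp
    show "c < norm (B (z /\<^sub>R norm z))"
      using z nz by (simp add: blinfun.scaleR_right field_simps)
  qed
qed

lemma bj_orthogonal_uminus_right: "x \<bottom>\<^sub>B y \<Longrightarrow> x \<bottom>\<^sub>B - y"
  unfolding bj_orthogonal_def by (metis scaleR_minus_left scaleR_minus_right)

text \<open>Substituting \<open>- t\<close> for \<open>t\<close> swaps the two half-lines.
  Everything about \<open>eps_minus\<close> and \<open>A\<close> thereby reduces to
  \<open>eps_plus\<close> and \<open>- A\<close>.\<close>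

lemma eps_minus_iff_eps_plus_uminus: "v \<in> eps_minus e u \<longleftrightarrow> - v \<in> eps_plus e u"
proof
  assume "v \<in> eps_minus e u"
  then have "sqrt (1 - e\<^sup>2) * norm u \<le> norm (u + (- t) *\<^sub>R v)" if "0 \<le> t" for t
    using that unfolding eps_minus_def by (blast intro: iffD2[OF neg_le_0_iff_le])
  then show "- v \<in> eps_plus e u"
    unfolding eps_plus_def by simp
next
  assume "- v \<in> eps_plus e u"
  then have "sqrt (1 - e\<^sup>2) * norm u \<le> norm (u + (- t) *\<^sub>R (- v))" if "t \<le> 0" for t
    using that unfolding eps_plus_def by (blast intro: iffD2[OF neg_0_le_iff_le])
  then show "v \<in> eps_minus e u"
    unfolding eps_minus_def by simp
qed

text \<open>Orthogonality keeps the whole line outside the open unit ball. If \<open>x + t y\<close>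
  had norm 1, its midpoint with \<open>x\<close>, again on the line, would have norm exactly 1, and
  rotundity would force \<open>t y = 0\<close>.\<close>

lemma rotund_bj_orthogonal_norm_gt:
  assumes "rotund_point x" "x \<bottom>\<^sub>B y" "y \<noteq> 0" "t \<noteq> 0"
  shows "1 < norm (x + t *\<^sub>R y)"
proof (rule ccontr)
  assume "\<not> 1 < norm (x + t *\<^sub>R y)"
  moreover have nx: "norm x = 1"
    using assms(1) by (simp add: rotund_point_def)
  moreover have ge: "1 \<le> norm (x + r *\<^sub>R y)" for r
    using assms(2) nx by (simp add: bj_orthogonal_def)
  ultimately have eq: "norm (x + t *\<^sub>R y) = 1"
    by (meson antisym not_le)
  have mid: "(x + (x + t *\<^sub>R y)) /\<^sub>R 2 = x + (t / 2) *\<^sub>R y"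
    by (simp add: scaleR_add_right flip: add.assoc scaleR_add_left)
  have "norm (x + (x + t *\<^sub>R y)) \<le> 2"
    using norm_triangle_ineq[of x "x + t *\<^sub>R y"] nx eq by simp
  then have "norm ((x + (x + t *\<^sub>R y)) /\<^sub>R 2) \<le> 1"
    by (simp only: norm_scaleR) simp
  then have "norm ((x + (x + t *\<^sub>R y)) /\<^sub>R 2) = 1"
    using ge[of "t / 2"] unfolding mid by (rule antisym)
  with eq assms(1) have "x = x + t *\<^sub>R y"
    unfolding rotund_point_def by blast
  then show False
    using assms(3,4) by simp
qed

text \<open>The point at parameter \<open>r\<close> is a convex combination of those at 0 and
  \<open>t\<close>, so its norm cannot exceed \<open>norm u\<close> if the norm at \<open>t\<close>
  is smaller than \<open>norm u\<close>.\<close>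

lemma norm_ray_ge:
  assumes "0 < r" "r \<le> t" "norm u < norm (u + r *\<^sub>R v)"
  shows "norm u \<le> norm (u + t *\<^sub>R v)"
proof (rule ccontr)
  assume less: "\<not> ?thesis"
  have t: "0 < t"
    using assms by simp
  have "u + r *\<^sub>R v = (1 - r / t) *\<^sub>R u + (r / t) *\<^sub>R (u + t *\<^sub>R v)"
    using t by (simp add: algebra_simps)
  also have "norm \<dots> \<le> norm ((1 - r / t) *\<^sub>R u) + norm ((r / t) *\<^sub>R (u + t *\<^sub>R v))"
    by (rule norm_triangle_ineq)
  also have "\<dots> = (1 - r / t) * norm u + (r / t) * norm (u + t *\<^sub>R v)"
    using assms t by simp
  also have "\<dots> \<le> (1 - r / t) * norm u + (r / t) * norm u"
    using assms t less by (intro add_left_mono mult_left_mono) auto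
  also have "\<dots> = norm u"
    by (simp add: algebra_simps)
  finally show False
    using assms(3) by simp
qed

lemma rotund_bj_orthogonal_witness:
  fixes T A :: "'a::real_normed_vector \<Rightarrow>\<^sub>L 'b::real_normed_vector"
  assumes "rotund_point T" "T \<bottom>\<^sub>B A" "0 < s" "s \<le> 1/4"
  obtains x where "norm x = 1" "1 - s \<le> norm (T x)"
    "\<And>t. 0 \<le> t \<Longrightarrow> (1 - 2 * s) * norm (T x) \<le> norm (T x + t *\<^sub>R A x)"
proof (cases "A = 0")
  \<comment> \<open>Here \<open>T + r A = T\<close> never leaves the unit ball, so \<open>x\<close>
    comes from the norm of \<open>T\<close> directly.\<close>
  case True
  have "norm T = 1"
    using assms(1) by (simp add: rotund_point_def)
  then obtain x where x: "norm x = 1" "1 - s < norm (T x)"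
    using blinfun_norm_witness[of "1 - s" T] assms(3,4) by auto
  have "(1 - 2 * s) * norm (T x) \<le> norm (T x)"
    using assms(3,4) by (simp add: mult_left_le_one_le)
  with x True show thesis
    by (intro that) auto
next
  case False
  \<comment> \<open>With this choice \<open>r A\<close> has norm \<open>s\<close>, so the same
    \<open>s\<close> bounds both the gap between \<open>norm (T x)\<close> and 1 and the drop along
    \<open>[0, r]\<close>.\<close>
  define r where "r = s / norm A"
  have r: "0 < r" "r * norm A = s"
    using False assms(3) by (auto simp: r_def)
  obtain x where x: "norm x = 1" "1 < norm ((T + r *\<^sub>R A) x)"
    using rotund_bj_orthogonal_norm_gt[OF assms(1,2) False, of r] r
      blinfun_norm_witness[of 1 "T + r *\<^sub>R A"] by auto
  then have gt: "1 < norm (T x + r *\<^sub>R A x)"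
    by (simp add: blinfun.add_left blinfun.scaleR_left)
  have Tx: "norm (T x) \<le> 1"
    using norm_blinfun[of T x] x assms(1) by (simp add: rotund_point_def)
  have Ax: "norm (t *\<^sub>R A x) \<le> s" if "0 \<le> t" "t \<le> r" for t
  proof -
    have "norm (A x) \<le> norm A"
      using norm_blinfun[of A x] x by simp
    then have "t * norm (A x) \<le> r * norm A"
      using that by (intro mult_mono) auto
    then show ?thesis
      using that r by simp
  qed
  have low: "1 - s \<le> norm (T x)"
    using norm_triangle_ineq[of "T x" "r *\<^sub>R A x"] gt Ax[of r] r by simp
  show thesis
  proof (rule that[OF x(1) low])
    fix t :: real
    assume t: "0 \<le> t"
    show "(1 - 2 * s) * norm (T x) \<le> norm (T x + t *\<^sub>R A x)"
    proof (cases "t \<le> r")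
      case True
      \<comment> \<open>Since \<open>norm (T x) \<ge> 1 - s \<ge> 3/4\<close>, the absolute loss
        \<open>s\<close> is at most the relative loss \<open>2 s norm (T x)\<close>; this is the
        origin of the factor \<open>1 - 2 s\<close>.\<close>
      have "s * 1 \<le> s * (2 * norm (T x))"
        using low assms(3,4) by (intro mult_left_mono) auto
      moreover have "norm (T x) - s \<le> norm (T x + t *\<^sub>R A x)"
        using norm_diff_ineq[of "T x" "t *\<^sub>R A x"] Ax[OF t True] by simp
      ultimately show ?thesis
        by (simp add: algebra_simps)
    next
      case False
      then have "norm (T x) \<le> norm (T x + t *\<^sub>R A x)"
        using norm_ray_ge[of r t "T x" "A x"] r gt Tx by simp
      moreover have "(1 - 2 * s) * norm (T x) \<le> norm (T x)"
        using assms(3,4) by (simp add: mult_left_le_one_le)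
      ultimately show ?thesis
        by simp
    qed
  qed
qed

lemma rotund_bj_orthogonal_imp_seq:
  fixes T A :: "'a::real_normed_vector \<Rightarrow>\<^sub>L 'b::real_normed_vector"
  assumes "rotund_point T" "T \<bottom>\<^sub>B A"
  obtains x :: "nat \<Rightarrow> 'a" and e :: "nat \<Rightarrow> real"
  where "\<And>n. norm (x n) = 1" "\<And>n. 0 < e n" "\<And>n. e n < 1" "e \<longlonglongrightarrow> 0"
    "(\<lambda>n. norm (T (x n))) \<longlonglongrightarrow> norm T" "\<And>n. A (x n) \<in> eps_plus (e n) (T (x n))"
proof -
  define s :: "nat \<Rightarrow> real" where "s n = (1/4) * inverse (real (Suc n))" for n
  have s: "0 < s n" "s n \<le> 1/4" for n
    by (auto simp: s_def field_simps)
  have s0: "s \<longlonglongrightarrow> 0"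
    unfolding s_def by (rule tendsto_mult_right_zero[OF LIMSEQ_inverse_real_of_nat])
  have "\<exists>z. norm z = 1 \<and> 1 - s n \<le> norm (T z) \<and>
      (\<forall>t\<ge>0. (1 - 2 * s n) * norm (T z) \<le> norm (T z + t *\<^sub>R A z))" for n
    using rotund_bj_orthogonal_witness[OF assms s] by metis
  then obtain x where x: "\<And>n. norm (x n) = 1" "\<And>n. 1 - s n \<le> norm (T (x n))"
      "\<And>n t. 0 \<le> t \<Longrightarrow> (1 - 2 * s n) * norm (T (x n)) \<le> norm (T (x n) + t *\<^sub>R A (x n))"
    by metis
  \<comment> \<open>Solves \<open>sqrt (1 - e^2) = 1 - 2 s\<close> for \<open>e\<close>. As
    \<open>0 < s n \<le> 1/4\<close>, the right-hand side lies in \<open>[1/2, 1)\<close>, which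
    makes \<open>e n\<close> both positive and less than 1.\<close>
  define e where "e n = sqrt (1 - (1 - 2 * s n)\<^sup>2)" for n
  have sq: "0 < (1 - 2 * s n)\<^sup>2" "(1 - 2 * s n)\<^sup>2 < 1" for n
    using s[of n] by (auto simp: power_less_one_iff)
  have "sqrt (1 - (e n)\<^sup>2) = 1 - 2 * s n" for n
    using sq[of n] s[of n] by (simp add: e_def)
  then have plus: "A (x n) \<in> eps_plus (e n) (T (x n))" for n
    using x(3) by (simp add: eps_plus_def)
  have "e \<longlonglongrightarrow> sqrt (1 - (1 - 2 * 0)\<^sup>2)"
    unfolding e_def by (intro tendsto_intros s0)
  then have e0: "e \<longlonglongrightarrow> 0"
    by simp
  have nT: "norm T = 1"
    using assms(1) by (simp add: rotund_point_def)
  have le1: "norm (T (x n)) \<le> 1" for n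
    using norm_blinfun[of T "x n"] x(1) nT by simp
  have "(\<lambda>n. 1 - s n) \<longlonglongrightarrow> 1 - 0"
    by (intro tendsto_intros s0)
  then have "(\<lambda>n. norm (T (x n))) \<longlonglongrightarrow> norm T"
    unfolding nT using x(2) le1
    by - (rule tendsto_sandwich[where f = "\<lambda>n. 1 - s n" and h = "\<lambda>_. 1"], auto)
  with x(1) plus e0 sq show thesis
    by (intro that[of x e]) (auto simp: e_def)
qed

lemma eps_plus_seq_imp_norm_le:
  fixes T A :: "'a::real_normed_vector \<Rightarrow>\<^sub>L 'b::real_normed_vector"
  assumes "\<And>n. norm (x n) = 1" "e \<longlonglongrightarrow> 0" "(\<lambda>n. norm (T (x n))) \<longlonglongrightarrow> norm T"
    "\<And>n. A (x n) \<in> eps_plus (e n) (T (x n))" "0 \<le> t"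
  shows "norm T \<le> norm (T + t *\<^sub>R A)"
proof -
  have "(\<lambda>n. sqrt (1 - (e n)\<^sup>2) * norm (T (x n))) \<longlonglongrightarrow> sqrt (1 - 0\<^sup>2) * norm T"
    by (intro tendsto_intros assms)
  moreover have "sqrt (1 - (e n)\<^sup>2) * norm (T (x n)) \<le> norm (T + t *\<^sub>R A)" for n
  proof -
    have "sqrt (1 - (e n)\<^sup>2) * norm (T (x n)) \<le> norm (T (x n) + t *\<^sub>R A (x n))"
      using assms(4)[of n] assms(5) by (simp add: eps_plus_def)
    also have "\<dots> \<le> norm (T + t *\<^sub>R A)"
      using norm_blinfun[of "T + t *\<^sub>R A" "x n"] assms(1)
      by (simp add: blinfun.add_left blinfun.scaleR_left)
    finally show ?thesis .
  qed
  ultimately show ?thesis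
    by (auto intro: LIMSEQ_le_const2)
qed

theorem theorem2p3:
  fixes T A :: "'a::real_normed_vector \<Rightarrow>\<^sub>L 'b::real_normed_vector"
  assumes "rotund_point T"
  shows "T \<bottom>\<^sub>B A \<longleftrightarrow>
    (\<exists>(x :: nat \<Rightarrow> 'a) (y :: nat \<Rightarrow> 'a) (\<epsilon> :: nat \<Rightarrow> real) (\<delta> :: nat \<Rightarrow> real).
       (\<forall>n. x n \<in> sphere 0 1 \<and> y n \<in> sphere 0 1) \<and>
       (\<forall>n. 0 < \<epsilon> n \<and> \<epsilon> n \<in> {0..<1} \<and> 0 < \<delta> n \<and> \<delta> n \<in> {0..<1}) \<and>
       (\<epsilon> \<longlonglongrightarrow> 0 \<and> \<delta> \<longlonglongrightarrow> 0) \<and>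
       ((\<lambda>n. norm (blinfun_apply T (x n))) \<longlonglongrightarrow> norm T \<and>
        (\<lambda>n. norm (blinfun_apply T (y n))) \<longlonglongrightarrow> norm T) \<and>
       (\<forall>n. blinfun_apply A (x n) \<in> eps_plus (\<epsilon> n) (blinfun_apply T (x n)) \<and>
            blinfun_apply A (y n) \<in> eps_minus (\<delta> n) (blinfun_apply T (y n))))" (is "_ \<longleftrightarrow> ?rhs")
proof
  assume orth: "T \<bottom>\<^sub>B A"
  obtain x e where "\<And>n. norm (x n) = 1" "\<And>n. 0 < e n" "\<And>n. e n < 1" "e \<longlonglongrightarrow> 0"
    "(\<lambda>n. norm (T (x n))) \<longlonglongrightarrow> norm T" "\<And>n. A (x n) \<in> eps_plus (e n) (T (x n))"
    using rotund_bj_orthogonal_imp_seq[OF assms orth] by blast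
  moreover obtain y d where "\<And>n. norm (y n) = 1" "\<And>n. 0 < d n" "\<And>n. d n < 1" "d \<longlonglongrightarrow> 0"
    "(\<lambda>n. norm (T (y n))) \<longlonglongrightarrow> norm T" "\<And>n. (- A) (y n) \<in> eps_plus (d n) (T (y n))"
    using rotund_bj_orthogonal_imp_seq[OF assms bj_orthogonal_uminus_right[OF orth]] by blast
  ultimately show ?rhs
    by (intro exI[of _ x] exI[of _ y] exI[of _ e] exI[of _ d])
      (simp add: eps_minus_iff_eps_plus_uminus blinfun.minus_left less_imp_le)
next
  assume ?rhs
  then obtain x y e d where *: "\<And>n. norm (x n) = 1" "\<And>n. norm (y n) = 1"
    "e \<longlonglongrightarrow> 0" "d \<longlonglongrightarrow> 0"
    "(\<lambda>n. norm (T (x n))) \<longlonglongrightarrow> norm T" "(\<lambda>n. norm (T (y n))) \<longlonglongrightarrow> norm T"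
    "\<And>n. A (x n) \<in> eps_plus (e n) (T (x n))" "\<And>n. (- A) (y n) \<in> eps_plus (d n) (T (y n))"
    unfolding eps_minus_iff_eps_plus_uminus blinfun.minus_left by (metis dist_0_norm mem_sphere)
  show "T \<bottom>\<^sub>B A"
    unfolding bj_orthogonal_def
  proof
    fix t :: real
    show "norm T \<le> norm (T + t *\<^sub>R A)"
      \<comment> \<open>The sequence \<open>x\<close> handles \<open>t \<ge> 0\<close>. For
        \<open>t < 0\<close>, the sequence \<open>y\<close> is used with \<open>- A\<close> and the
        positive parameter \<open>- t\<close>, which gives the same operator
        \<open>T + t A\<close>.\<close>
      using eps_plus_seq_imp_norm_le[OF *(1,3,5,7), of t]
        eps_plus_seq_imp_norm_le[OF *(2,4,6,8), of "- t"] by (cases "0 \<le> t") auto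
  qed
qed

end
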